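(* Let $G$ be a finite simple undirected graph, let $k$ be a positive integer, and let $q$ be a prime power. Then there exist a monic polynomial $f\in\mathbb{F}_q[x]$ and a set $D=\{f_1,f_2,\ldots,f_k\}$ of $k$ distinct monic divisors of $f$, with $f\notin D$, such that $G$ is an induced subgraph of the gcd-graph $G_f(D)$.
   Context: For a nonzero monic $f\in\mathbb{F}_q[x]$ and a set $D$ of monic divisors of $f$ with $f\notin D$, the gcd-graph $G_f(D)$ is the undirected loopless graph with vertex set the ring $\mathbb{F}_q[x]/(f)$ in which two vertices $u,v$ are adjacent if and only if $\gcd(u-v,f)\in D$ (gcd's monic, $\gcd(0,f)=f$). "$G_1$ is an induced subgraph of $G_2$" means that there is an injective map $V(G_1)\to V(G_2)$ such that two vertices of $G_1$ are adjacent if and only if their images are adjacent in $G_2$. *)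

theory Defs
  imports
    "Graph_Theory.Pair_Digraph"
    "HOL-Computational_Algebra.Polynomial_Factorial"
    "HOL-Library.Cardinality"
    "HOL-Number_Theory.Cong"
    "HOL-Number_Theory.Prime_Powers"
begin

text \<open>
  The library's \<open>gcd\<close> on polynomials needs coefficients of class \<open>field_gcd\<close>, a field that carries
  its own (trivial) \<open>gcd\<close>, \<open>normalize\<close>, etc.\ operations. The following works over every field and
  agrees with \<open>gcd\<close> over a \<open>field_gcd\<close> (lemma \<open>monic_gcd_eq_gcd\<close>). The result is monic unless both
  arguments are 0.
\<close>
definition monic_gcd :: "'a::field poly \<Rightarrow> 'a poly \<Rightarrow> 'a poly" where
  "monic_gcd a b = (THE d. (d = 0 \<or> lead_coeff d = 1) \<and> d dvd a \<and> d dvd b \<and>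
     (\<forall>c. c dvd a \<longrightarrow> c dvd b \<longrightarrow> c dvd d))"

lemma monic_dvd_antisym:
  fixes d e :: "'a::field poly"
  assumes "d = 0 \<or> lead_coeff d = 1" "e = 0 \<or> lead_coeff e = 1" "d dvd e" "e dvd d"
  shows "d = e"
proof (cases "d = 0")
  case True
  then show ?thesis using assms by auto
next
  case False
  with assms have "e \<noteq> 0" by auto
  from assms(3) obtain c where c: "e = d * c" by (auto elim: dvdE)
  have "degree e \<le> degree d" "degree d \<le> degree e"
    using assms False \<open>e \<noteq> 0\<close> by (auto intro: dvd_imp_degree_le)
  with c False \<open>e \<noteq> 0\<close> have "degree c = 0" by (auto simp: degree_mult_eq)
  then obtain a where a: "c = [:a:]" by (auto elim: degree_eq_zeroE)
  from assms False \<open>e \<noteq> 0\<close> have "lead_coeff d = 1" "lead_coeff e = 1" by auto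
  with c a have "a = 1" by (auto split: if_splits)
  with c a show ?thesis by simp
qed

lemma monic_gcd_eqI:
  assumes "d = 0 \<or> lead_coeff d = 1" "d dvd a" "d dvd b"
    "\<And>c. c dvd a \<Longrightarrow> c dvd b \<Longrightarrow> c dvd d"
  shows "monic_gcd a b = d"
  unfolding monic_gcd_def
  by (rule the_equality) (use assms in \<open>auto intro!: monic_dvd_antisym\<close>)

lemma monic_gcd_exists:
  fixes a b :: "'a::field poly"
  shows "\<exists>d. (d = 0 \<or> lead_coeff d = 1) \<and> d dvd a \<and> d dvd b \<and>
     (\<forall>c. c dvd a \<longrightarrow> c dvd b \<longrightarrow> c dvd d)"
proof (induction "if b = 0 then 0 else Suc (degree b)" arbitrary: a b rule: less_induct)
  case less
  show ?case
  proof (cases "b = 0")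
    case True
    show ?thesis
    proof (cases "a = 0")
      case True
      with \<open>b = 0\<close> show ?thesis by (intro exI[of _ 0]) auto
    next
      case False
      let ?d = "smult (inverse (lead_coeff a)) a"
      have "lead_coeff ?d = 1" using False by simp
      moreover have "?d dvd a" using False by (simp add: smult_dvd_iff)
      moreover have "c dvd ?d" if "c dvd a" for c using that by (rule dvd_smult)
      ultimately show ?thesis using \<open>b = 0\<close> by (intro exI[of _ ?d]) auto
    qed
  next
    case False
    have "(if a mod b = 0 then 0 else Suc (degree (a mod b))) < (if b = 0 then 0 else Suc (degree b))"
      using False degree_mod_less[of b a] by auto
    from less[OF this, of b] obtain d where d: "d = 0 \<or> lead_coeff d = 1" "d dvd b" "d dvd a mod b"
      "\<forall>c. c dvd b \<longrightarrow> c dvd a mod b \<longrightarrow> c dvd d" by auto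
    have "c dvd a mod b \<longleftrightarrow> c dvd a" if "c dvd b" for c
      using that by (rule dvd_mod_iff)
    with d show ?thesis by (intro exI[of _ d]) auto
  qed
qed

lemma
  fixes a b :: "'a::field poly"
  shows monic_gcd_monic: "monic_gcd a b = 0 \<or> lead_coeff (monic_gcd a b) = 1"
    and monic_gcd_dvd1: "monic_gcd a b dvd a"
    and monic_gcd_dvd2: "monic_gcd a b dvd b"
    and monic_gcd_greatest: "c dvd a \<Longrightarrow> c dvd b \<Longrightarrow> c dvd monic_gcd a b"
proof -
  from monic_gcd_exists[of a b] obtain d where d: "d = 0 \<or> lead_coeff d = 1" "d dvd a" "d dvd b"
    "\<forall>c. c dvd a \<longrightarrow> c dvd b \<longrightarrow> c dvd d" by blast
  then have "monic_gcd a b = d" by (intro monic_gcd_eqI) auto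
  with d show "monic_gcd a b = 0 \<or> lead_coeff (monic_gcd a b) = 1" "monic_gcd a b dvd a"
    "monic_gcd a b dvd b" "c dvd a \<Longrightarrow> c dvd b \<Longrightarrow> c dvd monic_gcd a b" by auto
qed

lemma monic_gcd_eq_gcd:
  fixes a b :: "'a::field_gcd poly"
  shows "monic_gcd a b = gcd a b"
proof (rule monic_gcd_eqI)
  show "gcd a b = 0 \<or> lead_coeff (gcd a b) = 1"
  proof (cases "gcd a b = 0")
    case False
    have "unit_factor (gcd a b) = 1" using False by (simp add: unit_factor_gcd)
    then have "unit_factor (lead_coeff (gcd a b)) = 1"
      by (simp add: unit_factor_poly_def one_pCons)
    then show ?thesis using False by (simp add: is_unit_unit_factor dvd_field_iff)
  qed auto
qed auto

lemma monic_gcd_0_left: "lead_coeff f = 1 \<Longrightarrow> monic_gcd 0 f = f"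
  by (rule monic_gcd_eqI) auto

lemma monic_gcd_minus: "monic_gcd (- a) b = monic_gcd a b"
  by (rule monic_gcd_eqI) (auto simp: monic_gcd_dvd1 monic_gcd_dvd2 monic_gcd_greatest monic_gcd_monic)

lemma monic_gcd_cong:
  fixes a b f :: "'a::field poly"
  assumes "[a = b] (mod f)"
  shows "monic_gcd a f = monic_gcd b f"
proof (rule monic_gcd_eqI)
  have eq: "c dvd a \<longleftrightarrow> c dvd b" if "c dvd f" for c
    using assms that by (metis cong_def dvd_mod_iff)
  show "monic_gcd b f = 0 \<or> lead_coeff (monic_gcd b f) = 1" by (rule monic_gcd_monic)
  show "monic_gcd b f dvd a" "monic_gcd b f dvd f"
    using eq monic_gcd_dvd1 monic_gcd_dvd2 by blast+
  show "c dvd monic_gcd b f" if "c dvd a" "c dvd f" for c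
    using eq that monic_gcd_greatest by blast
qed

definition cong_rel :: "'a::field poly \<Rightarrow> 'a poly rel" where
  "cong_rel f = {(u, v). [u = v] (mod f)}"

lemma equiv_cong_rel: "equiv UNIV (cong_rel f)"
  by (rule equivI) (auto simp: cong_rel_def refl_on_def sym_def trans_def
      intro: cong_sym cong_trans)

text \<open>
  The vertices are the elements of the quotient of the polynomial ring by \<open>(f)\<close>, that is, the residue
  classes modulo \<open>f\<close>. Adjacency does not depend on the representatives (lemma
  \<open>gcd_graph_adj_iff\<close>), and no loops arise since \<open>gcd(0, f) = f\<close> and \<open>f \<notin> D\<close> (lemma
  \<open>gcd_graph_bidirected\<close>). An undirected edge is a pair of opposite arcs, as in \<open>pair_graph\<close>.
\<close>
definition gcd_graph :: "'a::field poly \<Rightarrow> 'a poly set \<Rightarrow> 'a poly set pair_pre_digraph" where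
  "gcd_graph f D = \<lparr> pverts = UNIV // cong_rel f,
     parcs = {(A, B). A \<in> UNIV // cong_rel f \<and> B \<in> UNIV // cong_rel f \<and>
       (\<exists>u\<in>A. \<exists>v\<in>B. monic_gcd (u - v) f \<in> D)} \<rparr>"

lemma gcd_graph_adj_iff:
  "(cong_rel f `` {u}, cong_rel f `` {v}) \<in> parcs (gcd_graph f D) \<longleftrightarrow> monic_gcd (u - v) f \<in> D"
proof -
  have eq: "monic_gcd (u' - v') f = monic_gcd (u - v) f"
    if "u' \<in> cong_rel f `` {u}" "v' \<in> cong_rel f `` {v}" for u' v'
    using that by (intro monic_gcd_cong cong_diff) (auto simp: cong_rel_def intro: cong_sym)
  have mem: "u \<in> cong_rel f `` {u}" "v \<in> cong_rel f `` {v}"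
    by (auto simp: cong_rel_def)
  have "(\<exists>u'\<in>cong_rel f `` {u}. \<exists>v'\<in>cong_rel f `` {v}. monic_gcd (u' - v') f \<in> D) \<longleftrightarrow>
      monic_gcd (u - v) f \<in> D"
    using eq mem by metis
  moreover have "cong_rel f `` {w} \<in> UNIV // cong_rel f" for w
    by (rule quotientI) simp
  ultimately show ?thesis
    unfolding gcd_graph_def by simp
qed

lemma gcd_graph_bidirected:
  assumes "lead_coeff f = 1" "f \<notin> D"
  shows "pair_bidirected_digraph (gcd_graph f D)"
proof
  show "fst e \<in> pverts (gcd_graph f D)" "snd e \<in> pverts (gcd_graph f D)"
    if "e \<in> parcs (gcd_graph f D)" for e
    using that by (auto simp: gcd_graph_def)
  have sym: "(B, A) \<in> parcs (gcd_graph f D)" if AB: "(A, B) \<in> parcs (gcd_graph f D)" for A B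
  proof -
    from AB obtain u v where uv: "A = cong_rel f `` {u}" "B = cong_rel f `` {v}"
      by (auto simp: gcd_graph_def elim!: quotientE)
    have "monic_gcd (v - u) f = monic_gcd (u - v) f"
      using monic_gcd_minus[of "u - v" f] by simp
    with AB uv show ?thesis by (simp add: gcd_graph_adj_iff)
  qed
  then show "symmetric (with_proj (gcd_graph f D))"
    by (simp add: symmetric_def sym_def)
  show "fst e \<noteq> snd e" if e: "e \<in> parcs (gcd_graph f D)" for e
  proof
    assume eq: "fst e = snd e"
    from e have "fst e \<in> UNIV // cong_rel f" by (auto simp: gcd_graph_def)
    then obtain u where "fst e = cong_rel f `` {u}" by (auto elim: quotientE)
    with eq have "e = (cong_rel f `` {u}, cong_rel f `` {u})" by (simp add: prod_eq_iff)
    with e have "monic_gcd (u - u) f \<in> D" using gcd_graph_adj_iff by metis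
    then show False using assms by (simp add: monic_gcd_0_left)
  qed
qed

text \<open>
  The library's \<open>induced_subgraph\<close> requires the vertices of \<open>G\<close> to be literally vertices of \<open>H\<close>;
  here it is up to renaming.
\<close>
definition is_induced_subgraph_of :: "'v pair_pre_digraph \<Rightarrow> 'w pair_pre_digraph \<Rightarrow> bool" where
  "is_induced_subgraph_of G H \<longleftrightarrow> (\<exists>\<phi>. \<phi> ` pverts G \<subseteq> pverts H \<and> inj_on \<phi> (pverts G) \<and>
     (\<forall>x\<in>pverts G. \<forall>y\<in>pverts G. (x, y) \<in> parcs G \<longleftrightarrow> (\<phi> x, \<phi> y) \<in> parcs H))"

end

theory Submission
  imports Defs
begin

text \<open>
  The unitary graph \<open>G\<^sub>f({1})\<close> already contains every finite graph. If \<open>f\<close> is a product of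
  pairwise coprime nonconstant moduli \<open>m\<close>, the difference of two residues is a unit modulo \<open>f\<close> iff it
  is one modulo every \<open>m\<close>. Assigning to each vertex its residue modulo \<open>m\<close> is a colouring of the
  vertices, and if distinct colours differ by a unit modulo \<open>m\<close>, then two vertices are adjacent iff
  every colouring separates them. Thus it suffices to find colourings, one for each non-adjacent pair,
  that identify this pair and nothing else; together they describe the graph
  (a representation as an induced subgraph of a direct product of complete graphs).

  Arbitrary colourings can be realised one after the other (\<open>extend_modulus_by_colouring\<close>,
  \<open>polynomials_realising_colourings\<close>): represent the colours by powers of \<open>x\<close>, let \<open>Q\<close> be a common
  multiple of their differences and use the modulus \<open>1 + x Q f\<close>. As in Euclid's proof that there are
  infinitely many primes, it is coprime to \<open>Q\<close>, so that distinct colours differ by units, and to the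
  product \<open>f\<close> of the earlier moduli.

  For \<open>k\<close> divisors, everything is multiplied by \<open>x\<^bsup>k-1\<^esup>\<close>: the gcds that occur between
  images of vertices are then multiples of \<open>x\<^bsup>k-1\<^esup>\<close>, and among \<open>1, x, \<dots>, x\<^bsup>k-1\<^esup>\<close> only
  the last can be one of them; it is attained exactly where the gcd was 1 before.
\<close>

section \<open>Gcds and comaximality\<close>

lemma monic_gcd_eq_1_iff_coprime: "monic_gcd a b = 1 \<longleftrightarrow> coprime a (b :: 'a::field poly)"
proof
  assume "monic_gcd a b = 1"
  then show "coprime a b" by (metis coprimeI monic_gcd_greatest)
next
  assume "coprime a b"
  then show "monic_gcd a b = 1"
    by (intro monic_gcd_eqI) (auto intro: coprime_common_divisor)
qed

lemma monic_gcd_mult_left: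
  fixes a b h :: "'a::field poly"
  assumes "lead_coeff h = 1"
  shows "monic_gcd (h * a) (h * b) = h * monic_gcd a b"
proof (rule monic_dvd_antisym)
  have h: "h \<noteq> 0" using assms by auto
  have "h dvd monic_gcd (h * a) (h * b)" by (intro monic_gcd_greatest) auto
  then obtain t where t: "monic_gcd (h * a) (h * b) = h * t" by (auto elim: dvdE)
  have "h * t dvd h * a" "h * t dvd h * b"
    using monic_gcd_dvd1 monic_gcd_dvd2 t by metis+
  with h have "t dvd monic_gcd a b" by (intro monic_gcd_greatest) auto
  then show "monic_gcd (h * a) (h * b) dvd h * monic_gcd a b" by (simp add: t)
  show "h * monic_gcd a b dvd monic_gcd (h * a) (h * b)"
    by (intro monic_gcd_greatest mult_dvd_mono) (auto simp: monic_gcd_dvd1 monic_gcd_dvd2)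
  show "h * monic_gcd a b = 0 \<or> lead_coeff (h * monic_gcd a b) = 1"
    using assms monic_gcd_monic[of a b] by (auto simp: lead_coeff_mult)
qed (rule monic_gcd_monic)

text \<open>
  A Bezout identity, unlike the absence of common divisors, passes to products of moduli by mere
  algebra.
\<close>
definition comaximal :: "'a::comm_ring_1 \<Rightarrow> 'a \<Rightarrow> bool" where
  "comaximal a b \<longleftrightarrow> (\<exists>s t. s * a + t * b = 1)"

lemma comaximal_imp_coprime:
  fixes a b :: "'a::field poly"
  assumes "comaximal a b"
  shows "coprime a b"
  using assms unfolding comaximal_def by (metis coprimeI dvd_add dvd_mult)

lemma comaximal_mult_right:
  assumes "comaximal a b" "comaximal a c"
  shows "comaximal a (b * c)"
proof -
  obtain s t s' t' where "s * a + t * b = 1" "s' * a + t' * c = 1"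
    using assms unfolding comaximal_def by blast
  then have "(s * a + t * b) * (s' * a + t' * c) = 1" by simp
  then have "(s * s' * a + s * t' * c + t * b * s') * a + (t * t') * (b * c) = 1"
    by (simp add: algebra_simps)
  then show ?thesis unfolding comaximal_def by blast
qed

lemma comaximal_cong:
  assumes "comaximal a f" "f dvd a' - a"
  shows "comaximal a' f"
proof -
  obtain s t where st: "s * a + t * f = 1" using assms unfolding comaximal_def by blast
  obtain e where "a' - a = f * e" using assms by (auto elim: dvdE)
  then have "a' = a + f * e" by (simp add: algebra_simps)
  with st have "s * a' + (t - s * e) * f = 1" by (simp add: algebra_simps)
  then show ?thesis unfolding comaximal_def by blast
qed

section \<open>Realising colourings by residues\<close>

lemma finite_set_monic_common_multiple:
  fixes S :: "'a::field poly set"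
  assumes "finite S" "0 \<notin> S"
  obtains Q where "lead_coeff Q = 1" "\<And>d. d \<in> S \<Longrightarrow> d dvd Q"
proof
  let ?P = "\<Prod>S"
  have "?P \<noteq> 0" using assms by (simp add: prod_zero_iff)
  then show "lead_coeff (smult (inverse (lead_coeff ?P)) ?P) = 1" by simp
  show "d dvd smult (inverse (lead_coeff ?P)) ?P" if "d \<in> S" for d
    using dvd_prodI[OF assms(1) that, of "\<lambda>x. x"] by (intro dvd_smult) simp
qed

text \<open>
  This is a Chinese remainder step with an explicit solution: since \<open>m - x Q f = 1\<close>, the
  polynomial \<open>m u - x Q f w\<close> is congruent to \<open>u\<close> modulo \<open>f\<close> and to \<open>w\<close> modulo \<open>m\<close>.
\<close>
lemma extend_modulus_by_colouring:
  fixes f :: "'a::field poly" and u :: "'v \<Rightarrow> 'a poly" and \<sigma> :: "'v \<Rightarrow> nat"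
  assumes "finite V" "lead_coeff f = 1"
  obtains m u' where "lead_coeff m = 1" "\<not> m dvd 1" "\<And>v. f dvd u' v - u v"
    "\<And>a b. \<sigma> a = \<sigma> b \<Longrightarrow> m dvd u' a - u' b"
    "\<And>a b. a \<in> V \<Longrightarrow> b \<in> V \<Longrightarrow> \<sigma> a \<noteq> \<sigma> b \<Longrightarrow> comaximal (u' a - u' b) m"
proof -
  define w :: "'v \<Rightarrow> 'a poly" where "w v = monom 1 (\<sigma> v)" for v
  have w_eq: "w a = w b \<longleftrightarrow> \<sigma> a = \<sigma> b" for a b
    unfolding w_def by (metis degree_monom_eq one_neq_zero)
  define S where "S = (\<lambda>(a, b). w a - w b) ` {(a, b) \<in> V \<times> V. \<sigma> a \<noteq> \<sigma> b}"
  have "finite S" unfolding S_def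
    by (rule finite_imageI, rule finite_subset[of _ "V \<times> V"]) (auto simp: assms)
  moreover have "0 \<notin> S" using w_eq by (auto simp: S_def)
  ultimately obtain Q where Q: "lead_coeff Q = 1" "\<And>d. d \<in> S \<Longrightarrow> d dvd Q"
    by (rule finite_set_monic_common_multiple) (rule that)
  define X :: "'a poly" where "X = [:0, 1:]"
  define p where "p = X * (Q * f)"
  define m where "m = 1 + p"
  define u' where "u' v = m * u v - p * w v" for v
  \<comment> \<open>The factor \<open>x\<close> makes \<open>m\<close> nonconstant even if \<open>Q = f = 1\<close>.\<close>
  have "Q * f \<noteq> 0" using Q(1) assms(2) by auto
  then have deg: "degree p = Suc (degree (Q * f))"
    unfolding p_def X_def by (subst degree_mult_eq) auto
  have lead_p: "lead_coeff p = 1"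
    unfolding p_def X_def using Q(1) assms(2) by (simp only: lead_coeff_mult) simp
  have diff: "u' a - u' b = m * ((u a - u b) - (w a - w b)) + (w a - w b)" for a b
    unfolding u'_def m_def by (simp add: algebra_simps)
  show thesis
  proof
    show "lead_coeff m = 1"
      using lead_p deg unfolding m_def by (subst lead_coeff_add_le) auto
    have "degree m = degree p"
      unfolding m_def using deg by (intro degree_add_eq_right) simp
    with deg have "degree m > 0" by simp
    then show "\<not> m dvd 1" using is_unit_iff_degree[of m] by fastforce
    show "f dvd u' v - u v" for v
    proof -
      have "u' v - u v = p * (u v - w v)" unfolding u'_def m_def by (simp add: algebra_simps)
      then show ?thesis by (simp add: p_def)
    qed
    show "m dvd u' a - u' b" if "\<sigma> a = \<sigma> b" for a b
      using that w_eq[of a b] by (simp add: diff)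
    show "comaximal (u' a - u' b) m" if "a \<in> V" "b \<in> V" "\<sigma> a \<noteq> \<sigma> b" for a b
    proof (rule comaximal_cong)
      have "w a - w b \<in> S" using that by (auto simp: S_def)
      then obtain e where e: "Q = (w a - w b) * e" using Q(2) by (blast elim: dvdE)
      have "(- X * f * e) * (w a - w b) + 1 * m = 1"
        unfolding m_def p_def e by (simp add: algebra_simps)
      then show "comaximal (w a - w b) m" unfolding comaximal_def by blast
      show "m dvd (u' a - u' b) - (w a - w b)" by (simp add: diff)
    qed
  qed
qed

text \<open>
  The last property says that vertices separated by one colouring stay distinct modulo \<open>f\<close>; it makes the
  vertex map injective although non-adjacent vertices are identified by some colouring.
\<close>
lemma polynomials_realising_colourings:
  fixes C :: "('v \<Rightarrow> nat) set"
  assumes "finite C" "finite V"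
  shows "\<exists>(f :: 'a::field poly) u. lead_coeff f = 1 \<and> (C \<noteq> {} \<longrightarrow> \<not> f dvd 1) \<and>
    (\<forall>a\<in>V. \<forall>b\<in>V. (\<forall>\<sigma>\<in>C. \<sigma> a \<noteq> \<sigma> b) \<longrightarrow> comaximal (u a - u b) f) \<and>
    (\<forall>a\<in>V. \<forall>b\<in>V. (\<exists>\<sigma>\<in>C. \<sigma> a = \<sigma> b) \<longrightarrow> \<not> coprime (u a - u b) f) \<and>
    (\<forall>a\<in>V. \<forall>b\<in>V. (\<exists>\<sigma>\<in>C. \<sigma> a \<noteq> \<sigma> b) \<longrightarrow> \<not> f dvd u a - u b)"
  using assms(1)
proof induction
  case empty
  have "comaximal a 1" for a :: "'a poly"
    unfolding comaximal_def by (intro exI[of _ 0] exI[of _ 1]) simp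
  then show ?case by (intro exI[of _ 1]) simp
next
  case (insert \<sigma> C)
  from insert.IH obtain f :: "'a poly" and u where f: "lead_coeff f = 1"
    and comax: "\<forall>a\<in>V. \<forall>b\<in>V. (\<forall>\<sigma>\<in>C. \<sigma> a \<noteq> \<sigma> b) \<longrightarrow> comaximal (u a - u b) f"
    and ncop: "\<forall>a\<in>V. \<forall>b\<in>V. (\<exists>\<sigma>\<in>C. \<sigma> a = \<sigma> b) \<longrightarrow> \<not> coprime (u a - u b) f"
    and ndvd: "\<forall>a\<in>V. \<forall>b\<in>V. (\<exists>\<sigma>\<in>C. \<sigma> a \<noteq> \<sigma> b) \<longrightarrow> \<not> f dvd u a - u b"
    by (elim exE conjE) (rule that)
  obtain m u' where m: "lead_coeff m = 1" "\<not> m dvd 1" and u': "\<And>v. f dvd u' v - u v"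
    and same: "\<And>a b. \<sigma> a = \<sigma> b \<Longrightarrow> m dvd u' a - u' b"
    and diff: "\<And>a b. a \<in> V \<Longrightarrow> b \<in> V \<Longrightarrow> \<sigma> a \<noteq> \<sigma> b \<Longrightarrow> comaximal (u' a - u' b) m"
    by (rule extend_modulus_by_colouring[OF assms(2) f, of u \<sigma>]) (rule that)
  have diff_cong: "f dvd (u' a - u' b) - (u a - u b)" for a b
    using dvd_diff[OF u'[of a] u'[of b]] by (simp add: algebra_simps)
  have dvd_iff: "c dvd u' a - u' b \<longleftrightarrow> c dvd u a - u b" if "c dvd f" for a b c
    using dvd_trans[OF that diff_cong[of a b]] by (metis diff_add_cancel dvd_add_right_iff)
  show ?case
  proof (intro exI[of _ "f * m"] exI[of _ u'] conjI ballI impI)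
    show "lead_coeff (f * m) = 1" using f m by (simp add: lead_coeff_mult)
    show "\<not> f * m dvd 1" using m(2) dvd_mult_right by blast
  next
    fix a b assume "a \<in> V" "b \<in> V" "\<forall>\<sigma>'\<in>insert \<sigma> C. \<sigma>' a \<noteq> \<sigma>' b"
    then show "comaximal (u' a - u' b) (f * m)"
      using comax diff by (intro comaximal_mult_right comaximal_cong[OF _ diff_cong]) auto
  next
    fix a b assume ab: "a \<in> V" "b \<in> V" and "\<exists>\<sigma>'\<in>insert \<sigma> C. \<sigma>' a = \<sigma>' b"
    then consider "\<sigma> a = \<sigma> b" | "\<exists>\<sigma>'\<in>C. \<sigma>' a = \<sigma>' b" by auto
    then show "\<not> coprime (u' a - u' b) (f * m)"
    proof cases
      case 1
      with same m(2) show ?thesis by (meson coprime_common_divisor dvd_triv_right)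
    next
      case 2
      with ncop ab obtain c where "c dvd u a - u b" "c dvd f" "\<not> c dvd 1"
        unfolding coprime_def by blast
      with dvd_iff show ?thesis by (meson coprime_common_divisor dvd_mult2)
    qed
  next
    fix a b assume ab: "a \<in> V" "b \<in> V" and "\<exists>\<sigma>'\<in>insert \<sigma> C. \<sigma>' a \<noteq> \<sigma>' b"
    then consider "\<sigma> a \<noteq> \<sigma> b" | "\<exists>\<sigma>'\<in>C. \<sigma>' a \<noteq> \<sigma>' b" by auto
    then show "\<not> f * m dvd u' a - u' b"
    proof cases
      case 1
      then have "coprime (u' a - u' b) m" using diff ab comaximal_imp_coprime by blast
      with m(2) show ?thesis by (meson coprime_common_divisor dvd_mult_right dvd_refl)
    next
      case 2
      with ndvd ab dvd_iff[of f a b] show ?thesis by (meson dvd_mult_left dvd_refl)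
    qed
  qed
qed

section \<open>Embedding finite graphs\<close>

text \<open>
  For every non-adjacent pair \<open>a, b\<close>, the colouring \<open>h(b := h a)\<close>, with \<open>h\<close> injective, identifies
  this pair only. The colouring \<open>h\<close> itself makes the vertex map injective; if there are no vertices,
  it is the only colouring and keeps \<open>f\<close> nonconstant.
\<close>
lemma finite_graph_embeds_coprimality:
  assumes "pair_graph G"
  obtains f :: "'a::field poly" and u where "lead_coeff f = 1" "degree f > 0"
    "\<And>a b. a \<in> pverts G \<Longrightarrow> b \<in> pverts G \<Longrightarrow> coprime (u a - u b) f \<longleftrightarrow> (a, b) \<in> parcs G"
    "\<And>a b. a \<in> pverts G \<Longrightarrow> b \<in> pverts G \<Longrightarrow> f dvd u a - u b \<Longrightarrow> a = b"
proof -
  interpret pair_graph G by fact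
  let ?V = "pverts G"
  obtain h :: "_ \<Rightarrow> nat" where h: "inj_on h ?V"
    using finite_imp_inj_to_nat_seg[OF finite_verts] by auto
  define N where "N = {(a, b) \<in> ?V \<times> ?V. (a, b) \<notin> parcs G}"
  define C where "C = insert h ((\<lambda>(a, b). h(b := h a)) ` N)"
  have "finite N" unfolding N_def by (rule finite_subset[of _ "?V \<times> ?V"]) auto
  then have "finite C" by (simp add: C_def)
  from polynomials_realising_colourings[OF this finite_verts, where ?'a = 'a]
  obtain f :: "'a poly" and u where f: "lead_coeff f = 1" "C \<noteq> {} \<longrightarrow> \<not> f dvd 1"
    and comax: "\<forall>a\<in>?V. \<forall>b\<in>?V. (\<forall>\<sigma>\<in>C. \<sigma> a \<noteq> \<sigma> b) \<longrightarrow> comaximal (u a - u b) f"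
    and ncop: "\<forall>a\<in>?V. \<forall>b\<in>?V. (\<exists>\<sigma>\<in>C. \<sigma> a = \<sigma> b) \<longrightarrow> \<not> coprime (u a - u b) f"
    and ndvd: "\<forall>a\<in>?V. \<forall>b\<in>?V. (\<exists>\<sigma>\<in>C. \<sigma> a \<noteq> \<sigma> b) \<longrightarrow> \<not> f dvd u a - u b"
    by (elim exE conjE) (rule that)
  show thesis
  proof
    show "lead_coeff f = 1" by fact
    have "\<not> f dvd 1" "f \<noteq> 0" using f by (auto simp: C_def)
    then show "degree f > 0" by (simp add: is_unit_iff_degree)
    fix a b assume ab: "a \<in> ?V" "b \<in> ?V"
    show "a = b" if "f dvd u a - u b"
    proof -
      have "h a = h b" using that ndvd ab by (auto simp: C_def)
      then show ?thesis using h ab by (auto dest: inj_onD)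
    qed
    show "coprime (u a - u b) f \<longleftrightarrow> (a, b) \<in> parcs G"
    proof
      assume cop: "coprime (u a - u b) f"
      show "(a, b) \<in> parcs G"
      proof (rule ccontr)
        assume "(a, b) \<notin> parcs G"
        then have "(\<lambda>(a, b). h(b := h a)) (a, b) \<in> C"
          using ab unfolding C_def N_def by blast
        then have "\<exists>\<sigma>\<in>C. \<sigma> a = \<sigma> b" by (rule rev_bexI) auto
        with ncop ab cop show False by blast
      qed
    next
      assume adj: "(a, b) \<in> parcs G"
      then have "a \<noteq> b" using no_loops by fastforce
      have adj': "(b, a) \<in> parcs G" using adj arcs_symmetric by blast
      have "\<sigma> a \<noteq> \<sigma> b" if "\<sigma> \<in> C" for \<sigma>
        using that adj adj' \<open>a \<noteq> b\<close> ab
        by (auto simp: C_def N_def inj_on_eq_iff[OF h] split: if_splits)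
      with comax ab show "coprime (u a - u b) f" by (blast intro: comaximal_imp_coprime)
    qed
  qed
qed

theorem corollary8p3:
  fixes G :: "'v pair_pre_digraph" and k q :: nat
  assumes "pair_graph G"
    and "k > 0"
    and "primepow q" and "CARD('a::{field,finite}) = q"
  shows "\<exists>(f :: 'a poly) D. lead_coeff f = 1 \<and>
    (\<forall>d\<in>D. lead_coeff d = 1 \<and> d dvd f) \<and> card D = k \<and> f \<notin> D \<and>
    is_induced_subgraph_of G (gcd_graph f D)"
proof -
  obtain f :: "'a poly" and u where f: "lead_coeff f = 1" "degree f > 0"
    and cop: "\<And>a b. a \<in> pverts G \<Longrightarrow> b \<in> pverts G \<Longrightarrow>
      coprime (u a - u b) f \<longleftrightarrow> (a, b) \<in> parcs G"
    and inj: "\<And>a b. a \<in> pverts G \<Longrightarrow> b \<in> pverts G \<Longrightarrow> f dvd u a - u b \<Longrightarrow> a = b"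
    by (rule finite_graph_embeds_coprimality[OF assms(1), where ?'a = 'a]) (rule that)
  define x :: "nat \<Rightarrow> 'a poly" where "x = monom 1"
  define D where "D = x ` {..<k}"
  define h where "h = x (k - 1)"
  have lead_x: "lead_coeff (x i) = 1" and deg_x: "degree (x i) = i" for i
    by (auto simp: x_def degree_monom_eq)
  have h: "lead_coeff h = 1" "degree h = k - 1" "h \<noteq> 0"
    using lead_x[of "k - 1"] deg_x[of "k - 1"] by (auto simp: h_def)
  have deg_D: "degree d < k" if "d \<in> D" for d
    using that by (auto simp: D_def deg_x)
  have adj: "monic_gcd (h * d) (h * f) \<in> D \<longleftrightarrow> coprime d f" for d
  proof -
    have g: "monic_gcd d f \<noteq> 0" using monic_gcd_dvd2[of d f] f by auto
    then have lead: "lead_coeff (monic_gcd d f) = 1" using monic_gcd_monic by blast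
    have "h * monic_gcd d f \<in> D \<longleftrightarrow> monic_gcd d f = 1"
    proof
      assume "h * monic_gcd d f \<in> D"
      then have "degree (h * monic_gcd d f) < k" by (rule deg_D)
      then have "degree (monic_gcd d f) = 0" using h g by (simp add: degree_mult_eq)
      with lead show "monic_gcd d f = 1" by (auto elim: degree_eq_zeroE simp: one_pCons)
    qed (use \<open>k > 0\<close> in \<open>auto simp: D_def h_def\<close>)
    then show ?thesis by (simp only: monic_gcd_mult_left[OF h(1)] monic_gcd_eq_1_iff_coprime)
  qed
  define F where "F = h * f"
  define \<phi> where "\<phi> v = cong_rel F `` {h * u v}" for v
  show ?thesis
  proof (intro exI[of _ F] exI[of _ D] conjI ballI)
    show "lead_coeff F = 1" using f h by (simp add: F_def lead_coeff_mult)
    have "f \<noteq> 0" using f by auto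
    then have "degree F = k - 1 + degree f" using h by (simp add: F_def degree_mult_eq)
    with f have "degree F \<ge> k" by simp
    with deg_D show "F \<notin> D" by fastforce
    have "inj_on x {..<k}" using deg_x by (metis inj_onI)
    then show "card D = k" by (simp add: D_def card_image)
  next
    fix d assume "d \<in> D"
    then obtain i where i: "d = x i" "i < k" by (auto simp: D_def)
    then show "lead_coeff d = 1" using lead_x by simp
    have "h = x i * x (k - 1 - i)" using i by (simp add: h_def x_def mult_monom)
    with i show "d dvd F" by (simp add: F_def)
  next
    have "a = b" if ab: "a \<in> pverts G" "b \<in> pverts G" and "\<phi> a = \<phi> b" for a b
    proof -
      have "h * u a \<in> \<phi> b" unfolding that(3)[symmetric] by (simp add: \<phi>_def cong_rel_def)
      then have "[h * u b = h * u a] (mod F)" by (simp add: \<phi>_def cong_rel_def)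
      then have "h * f dvd h * u a - h * u b"
        by (metis F_def cong_sym cong_def mod_eq_dvd_iff)
      then have "f dvd u a - u b" using h by (simp flip: right_diff_distrib)
      with inj ab show ?thesis by blast
    qed
    moreover have "(\<phi> a, \<phi> b) \<in> parcs (gcd_graph F D) \<longleftrightarrow> (a, b) \<in> parcs G"
      if "a \<in> pverts G" "b \<in> pverts G" for a b
      using adj[of "u a - u b"] cop[OF that]
      by (simp add: \<phi>_def gcd_graph_adj_iff F_def flip: right_diff_distrib)
    moreover have "\<phi> v \<in> pverts (gcd_graph F D)" for v
      by (auto simp: \<phi>_def gcd_graph_def intro: quotientI)
    ultimately show "is_induced_subgraph_of G (gcd_graph F D)"
      unfolding is_induced_subgraph_of_def by (intro exI[of _ \<phi>]) (auto simp: inj_on_def)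
  qed
qed

end
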